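(* Let $X=Q_x\widetilde X\in\mathbb{R}^{m\times n}$ and $Y=Q_y\widetilde Y\in\mathbb{R}^{m\times n}$, where $Q_x\in\mathbb{R}^{m\times r_x}$, $Q_y\in\mathbb{R}^{m\times r_y}$ have orthonormal columns and $\widetilde X\in\mathbb{R}^{r_x\times n}$, $\widetilde Y\in\mathbb{R}^{r_y\times n}$ have full row rank. Let $A=YX^\dagger$, $Q_{x,y}=Q_x^TQ_y$, $G_{y,x}=\widetilde Y\widetilde X^T$, $G_x=\widetilde X\widetilde X^T$, so that $Q_x^TAQ_x=Q_{x,y}G_{y,x}G_x^{-1}$. Let $(w_i,\lambda_i)$ be an eigenpair (possibly complex) of $Q_x^TAQ_x$, i.e. $Q_x^TAQ_xw_i=\lambda_iw_i$, $w_i\neq\mathbf{0}$. Then the corresponding Exact DMD vector $\mathbf{z}_i^{(ex)}$ is $$\mathbf{z}_i^{(ex)}=Q_y\widetilde Y\widetilde X^\dagger w_i=Q_yG_{y,x}G_x^{-1}w_i,$$ and $A\mathbf{z}_i^{(ex)}=\lambda_i\mathbf{z}_i^{(ex)}$. Hence, if $\mathbf{z}_i^{(ex)}\neq\mathbf{0}$, it is an eigenvector of $A$. Moreover, if $\widetilde X=T\widetilde Q^T$ with $T\in\mathbb{R}^{r_x\times r_x}$ triangular, $\widetilde Q\in\mathbb{R}^{n\times r_x}$, $\widetilde Q^T\widetilde Q=I$, and $G_{y,q}=\widetilde Y\widetilde Q$, then $$\mathbf{z}_i^{(ex)}=Q_yw_i^{(ex)},\qquad w_i^{(ex)}=G_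{y,q}T^{-1}w_i.$$
   Context: $M^\dagger$ denotes the Moore–Penrose pseudoinverse. The Ritz vector corresponding to the eigenpair $(w_i,\lambda_i)$ of $Q_x^TAQ_x$ is $\mathbf{z}_i=Q_xw_i$, and the corresponding (unscaled) Exact DMD vector is defined as $\mathbf{z}_i^{(ex)}=YX^\dagger\mathbf{z}_i=YX^\dagger Q_xw_i$. *)

theory Defs
  imports "HOL-Analysis.Analysis"
begin

definition is_moore_penrose :: "real^'n^'m \<Rightarrow> real^'m^'n \<Rightarrow> bool" where
  "is_moore_penrose M P \<longleftrightarrow>
     M ** P ** M = M \<and> P ** M ** P = P \<and>
     transpose (M ** P) = M ** P \<and> transpose (P ** M) = P ** M"

lemma is_moore_penrose_unique:
  assumes "is_moore_penrose M P" "is_moore_penrose M R"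
  shows "P = R"
proof -
  have P: "M ** P ** M = M" "P ** M ** P = P"
      "transpose (M ** P) = M ** P" "transpose (P ** M) = P ** M"
    using assms(1) by (simp_all add: is_moore_penrose_def)
  have R: "M ** R ** M = M" "R ** M ** R = R"
      "transpose (M ** R) = M ** R" "transpose (R ** M) = R ** M"
    using assms(2) by (simp_all add: is_moore_penrose_def)
  have MP: "M ** P = M ** R"
  proof -
    have "M ** P = transpose ((M ** R) ** (M ** P))"
      using P(3) R(1) by (simp add: matrix_mul_assoc)
    also have "\<dots> = (M ** P) ** (M ** R)"
      using P(3) R(3) by (simp add: matrix_transpose_mul)
    also have "\<dots> = M ** R"
      using P(1) by (simp add: matrix_mul_assoc)
    finally show ?thesis .
  qed
  have PM: "P ** M = R ** M"
  proof -
    have "P ** M = transpose ((P ** M) ** (R ** M))"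
      using P(4) R(1) by (metis matrix_mul_assoc)
    also have "\<dots> = (R ** M) ** (P ** M)"
      using P(4) R(4) by (simp add: matrix_transpose_mul)
    also have "\<dots> = R ** M"
      using P(1) by (metis matrix_mul_assoc)
    finally show ?thesis .
  qed
  show ?thesis
    by (metis MP PM P(2) R(2) matrix_mul_assoc)
qed

lemma is_moore_penrose_exists:
  fixes M :: "real^'n^'m"
  shows "\<exists>P. is_moore_penrose M P"
proof -
  define N where "N = transpose M"
  define S where "S = range ((*v) N)"
  define U where "U = range ((*v) M)"
  have subS: "subspace S" and subU: "subspace U"
    unfolding S_def U_def by (auto intro!: linear_subspace_image subspace_UNIV matrix_vector_mul_linear)
  have adj: "(M *v x) \<bullet> y = x \<bullet> (N *v y)" for x y
    by (metis N_def dot_lmul_matrix inner_commute transpose_matrix_vector)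
  have perpS: "M *v t = 0 \<longleftrightarrow> (\<forall>s\<in>S. t \<bullet> s = 0)" for t
    unfolding S_def by (auto simp flip: adj)
  have adj': "v \<bullet> (M *v x) = (N *v v) \<bullet> x" for v x
    by (metis adj inner_commute)
  have perpU: "N *v v = 0 \<longleftrightarrow> (\<forall>u\<in>U. v \<bullet> u = 0)" for v
    unfolding U_def by (auto simp: adj')
  have TM0: "M *v x = 0" if "N *v (M *v x) = 0" for x
    using that adj[of x "M *v x"] by simp
  have ex: "\<exists>x. x \<in> S \<and> N *v (M *v x) = N *v y" for y
  proof -
    obtain u v where u: "u \<in> span U" and v: "\<And>w. w \<in> span U \<Longrightarrow> orthogonal v w" and y: "y = u + v"
      using orthogonal_subspace_decomp_exists by metis
    have Tv: "N *v v = 0"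
      using v perpU by (simp add: orthogonal_def span_base)
    from u obtain x0 where x0: "u = M *v x0"
      using subU unfolding U_def by (auto simp: span_eq_iff[THEN iffD2])
    obtain s t where s: "s \<in> span S" and t: "\<And>w. w \<in> span S \<Longrightarrow> orthogonal t w" and st: "x0 = s + t"
      using orthogonal_subspace_decomp_exists by metis
    have "M *v t = 0"
      using t perpS by (simp add: orthogonal_def span_base)
    then have "M *v s = u"
      by (simp add: x0 st matrix_vector_right_distrib)
    moreover have "s \<in> S"
      using s subS by (simp add: span_eq_iff[THEN iffD2])
    ultimately show ?thesis
      using Tv by (auto simp: y matrix_vector_right_distrib)
  qed
  have uniq: "x = x'"
    if "x \<in> S" "x' \<in> S" "N *v (M *v x) = N *v (M *v x')" for x x'
  proof -
    have "M *v (x - x') = 0"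
      using that(3) by (intro TM0) (simp add: matrix_vector_mult_diff_distrib)
    moreover have "x - x' \<in> S"
      using that subS by (simp add: subspace_diff)
    ultimately have "(x - x') \<bullet> (x - x') = 0"
      using perpS by blast
    then show ?thesis by simp
  qed
  obtain p where pS: "\<And>y. p y \<in> S" and pT: "\<And>y. N *v (M *v p y) = N *v y"
    using ex by metis
  have lin: "linear p"
  proof (rule linearI)
    show "p (a + b) = p a + p b" for a b
      by (rule uniq) (auto simp: pS pT subS subspace_add matrix_vector_right_distrib)
    show "p (c *\<^sub>R b) = c *\<^sub>R p b" for c b
      by (rule uniq) (auto simp: pS pT subS subspace_scale matrix_vector_mult_scaleR)
  qed
  define P where "P = matrix p"
  have P: "P *v y = p y" for y
    unfolding P_def by (rule matrix_works) (use lin in \<open>simp add: linear_linear linear_matrix_vector_mul_eq\<close>)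
  have MpM: "M *v p (M *v z) = M *v z" for z
    using TM0[of "p (M *v z) - z"]
    by (simp add: matrix_vector_mult_diff_distrib pT)
  have sym: "transpose B = B" if "\<And>a b. (B *v a) \<bullet> b = (B *v a) \<bullet> (B *v b)" for B :: "real^'k^'k"
  proof -
    have "(B *v a) \<bullet> b = (transpose B *v a) \<bullet> b" for a b
    proof -
      have "(B *v a) \<bullet> b = (B *v b) \<bullet> a"
        using that[of a b] that[of b a] by (simp add: inner_commute)
      also have "\<dots> = (transpose B *v a) \<bullet> b"
        by (metis dot_lmul_matrix inner_commute transpose_matrix_vector)
      finally show ?thesis .
    qed
    then show ?thesis
      by (metis matrix_eq vector_eq_rdot)
  qed
  have "M ** P ** M = M"
    by (simp add: matrix_eq P MpM flip: matrix_vector_mul_assoc)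
  moreover have "P ** M ** P = P"
    by (auto simp: matrix_eq P pS pT simp flip: matrix_vector_mul_assoc intro: uniq)
  moreover have "transpose (M ** P) = M ** P"
  proof (rule sym)
    fix a b
    have "(M *v p a) \<bullet> (b - M *v p b) = 0"
      by (simp add: adj matrix_vector_mult_diff_distrib pT)
    then show "((M ** P) *v a) \<bullet> b = ((M ** P) *v a) \<bullet> ((M ** P) *v b)"
      by (simp add: P inner_diff_right flip: matrix_vector_mul_assoc)
  qed
  moreover have "transpose (P ** M) = P ** M"
  proof (rule sym)
    fix a b
    have "M *v (b - p (M *v b)) = 0"
      by (simp add: matrix_vector_mult_diff_distrib MpM)
    then have "(b - p (M *v b)) \<bullet> p (M *v a) = 0"
      using perpS pS by blast
    then show "((P ** M) *v a) \<bullet> b = ((P ** M) *v a) \<bullet> ((P ** M) *v b)"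
      by (simp add: P inner_diff_left inner_commute[of "p (M *v a)"] flip: matrix_vector_mul_assoc)
  qed
  ultimately show ?thesis
    unfolding is_moore_penrose_def by blast
qed

definition pinv :: "real^'n^'m \<Rightarrow> real^'m^'n" where
  "pinv M = (THE P. is_moore_penrose M P)"

lemma is_moore_penrose_pinv: "is_moore_penrose M (pinv M)"
  unfolding pinv_def
  using is_moore_penrose_exists is_moore_penrose_unique by (metis theI)

definition orthonormal_columns :: "real^'r^'m \<Rightarrow> bool" where
  "orthonormal_columns Q \<longleftrightarrow>
     (\<forall>i j. column i Q \<bullet> column j Q = (if i = j then 1 else 0))"

definition full_row_rank :: "real^'n^'r \<Rightarrow> bool" where
  "full_row_rank M \<longleftrightarrow> rank M = CARD('r)"

definition triangular :: "real^('r::{finite,linorder})^('r::{finite,linorder}) \<Rightarrow> bool" where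
  "triangular T \<longleftrightarrow>
     (\<forall>i j. j < i \<longrightarrow> T $ i $ j = 0) \<or> (\<forall>i j. i < j \<longrightarrow> T $ i $ j = 0)"

text \<open>The data matrices are real but eigenvalues and eigenvectors may be complex, so real
  matrices act on complex vectors through their entrywise embedding.\<close>

abbreviation cmat :: "real^'n^'m \<Rightarrow> complex^'n^'m" where
  "cmat \<equiv> map_matrix complex_of_real"

definition eigenpair :: "complex^'n^'n \<Rightarrow> complex^'n \<Rightarrow> complex \<Rightarrow> bool" where
  "eigenpair M w l \<longleftrightarrow> M *v w = l *s w \<and> w \<noteq> 0"

definition ritz_vector :: "real^'r^'m \<Rightarrow> complex^'r \<Rightarrow> complex^'m" where
  "ritz_vector Q w = cmat Q *v w"

definition exact_dmd_vector ::
    "real^'n^'m \<Rightarrow> real^'n^'m \<Rightarrow> real^'r^'m \<Rightarrow> complex^'r \<Rightarrow> complex^'m" where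
  "exact_dmd_vector X Y Q w = cmat (Y ** pinv X) *v ritz_vector Q w"

end

theory Submission
  imports Defs
begin

text \<open>Orthonormality of the columns of $Q_x$ gives $X^\dagger = \widetilde X^\dagger Q_x^T$, so with
  $B = Y \widetilde X^\dagger$ we have $A = B Q_x^T$, $\mathbf{z}^{(ex)} = B w$ and
  $Q_x^T A Q_x = Q_x^T B$. The eigenvector property is then the usual exchange
  $(B Q_x^T) B w = B (Q_x^T B w) = \lambda B w$. The explicit formulas follow from
  $\widetilde X^\dagger = \widetilde X^T G_x^{-1}$, respectively
  $\widetilde X^\dagger = \widetilde Q T^{-1}$.\<close>

text \<open>The embedding of the reals into the complex numbers is a ring homomorphism, so
  identities between real matrices carry over to their action on complex vectors.\<close>

lemma cmat_mult: "cmat (A ** B) = cmat A ** cmat B"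
  by (simp add: map_matrix_def matrix_matrix_mult_def vec_eq_iff)

lemma pinv_eqI: "is_moore_penrose M P \<Longrightarrow> pinv M = P"
  using is_moore_penrose_pinv is_moore_penrose_unique by blast

lemma matrix_inv_left_right:
  fixes A :: "real^'n^'n"
  assumes "invertible A"
  shows "matrix_inv A ** A = mat 1" "A ** matrix_inv A = mat 1"
  using someI_ex[OF assms[unfolded invertible_def]] by (simp_all add: matrix_inv_def)

lemma orthonormal_columns_transpose_mult:
  assumes "orthonormal_columns Q"
  shows "transpose Q ** Q = mat 1"
  using assms
  by (auto simp: orthonormal_columns_def matrix_matrix_mult_def transpose_def column_def
      inner_vec_def mat_def vec_eq_iff)

text \<open>For \<open>x\<close> in the kernel of the Gram matrix, the squared norm of
  \<open>transpose M *v x\<close> is \<open>x\<close> paired with \<open>0\<close>; full row rank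
  makes \<open>transpose M\<close> injective, so \<open>x = 0\<close>.\<close>

lemma invertible_gram:
  assumes "full_row_rank M"
  shows "invertible (M ** transpose M)"
proof -
  have inj: "inj ((*v) (transpose M))"
    using assms by (simp add: full_row_rank_def rank_transpose flip: full_rank_injective)
  have "x = 0" if "(M ** transpose M) *v x = 0" for x
  proof -
    have "(transpose M *v x) \<bullet> (transpose M *v x) = x \<bullet> ((M ** transpose M) *v x)"
      by (metis dot_lmul_matrix matrix_vector_mul_assoc transpose_matrix_vector)
    then have "transpose M *v x = transpose M *v 0"
      using that by simp
    with inj show ?thesis by (rule injD)
  qed
  then show ?thesis
    by (simp add: invertible_left_inverse matrix_left_invertible_ker)
qed

text \<open>A right inverse settles three of the four Penrose equations at once, leaving only the
  symmetry of \<open>P ** M\<close>. Both explicit formulas for the pseudoinverse are obtained this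
  way.\<close>

lemma pinv_right_inverse:
  assumes "M ** P = mat 1" "transpose (P ** M) = P ** M"
  shows "pinv M = P"
proof (rule pinv_eqI)
  have "P ** M ** P = P"
    by (simp add: assms(1) flip: matrix_mul_assoc)
  then show "is_moore_penrose M P"
    using assms by (simp add: is_moore_penrose_def)
qed

lemma pinv_full_row_rank:
  assumes "full_row_rank M"
  shows "pinv M = transpose M ** matrix_inv (M ** transpose M)"
proof (rule pinv_right_inverse)
  let ?G = "M ** transpose M"
  note G = matrix_inv_left_right[OF invertible_gram[OF assms]]
  show "M ** (transpose M ** matrix_inv ?G) = mat 1"
    by (simp add: matrix_mul_assoc G)
  \<comment> \<open>\<open>?G\<close> is symmetric, so transposing its right inverse gives a left
    inverse, and the two must agree.\<close>
  have "transpose (matrix_inv ?G) ** ?G = transpose (?G ** matrix_inv ?G)"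
    by (simp add: matrix_transpose_mul)
  also have "\<dots> = mat 1"
    by (simp add: G)
  finally have "transpose (matrix_inv ?G) = matrix_inv ?G"
    by (metis G(2) matrix_mul_assoc matrix_mul_lid matrix_mul_rid)
  then show "transpose (transpose M ** matrix_inv ?G ** M) = transpose M ** matrix_inv ?G ** M"
    by (simp add: matrix_transpose_mul matrix_mul_assoc)
qed

lemma full_row_rank_mult_pinv: "full_row_rank M \<Longrightarrow> M ** pinv M = mat 1"
  by (simp add: pinv_full_row_rank matrix_mul_assoc matrix_inv_left_right invertible_gram)

text \<open>The factor \<open>transpose Q ** Q\<close> cancels wherever it arises, which reduces the
  Penrose equations to those of \<open>M\<close>.\<close>

lemma pinv_orthonormal_columns_mult:
  assumes "orthonormal_columns Q"
  shows "pinv (Q ** M) = pinv M ** transpose Q"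
proof (rule pinv_eqI)
  let ?P = "pinv M"
  have Q: "Z ** transpose Q ** Q = Z" for Z :: "real^'a^'k"
    using orthonormal_columns_transpose_mult[OF assms] by (simp flip: matrix_mul_assoc)
  have P: "M ** ?P ** M = M" "?P ** M ** ?P = ?P"
      "transpose (M ** ?P) = M ** ?P" "transpose (?P ** M) = ?P ** M"
    using is_moore_penrose_pinv[of M] by (simp_all add: is_moore_penrose_def)
  \<comment> \<open>The instantiated rules keep \<open>M ** ?P\<close> as one block, so that its own
    symmetry can be applied.\<close>
  have "transpose (Q ** (M ** ?P) ** transpose Q) = Q ** (M ** ?P) ** transpose Q"
    by (simp only: matrix_transpose_mul[of "Q ** (M ** ?P)"] matrix_transpose_mul[of Q] P(3)
        transpose_transpose) (simp add: matrix_mul_assoc)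
  moreover have "Q ** M ** ?P ** M = Q ** M"
    by (metis P(1) matrix_mul_assoc)
  ultimately show "is_moore_penrose (Q ** M) (?P ** transpose Q)"
    by (simp add: is_moore_penrose_def matrix_mul_assoc Q P)
qed

text \<open>\<open>R ** pinv (T ** R)\<close> is a right inverse of \<open>T\<close>, which suffices
  because \<open>T\<close> is square.\<close>

lemma invertible_left_factor:
  fixes T :: "real^'r^'r"
  assumes "full_row_rank (T ** R)"
  shows "invertible T"
  using full_row_rank_mult_pinv[OF assms]
  by (metis invertible_right_inverse matrix_mul_assoc)

text \<open>The candidate is a right inverse, and multiplied in the other order it gives the
  symmetric matrix \<open>Q ** transpose Q\<close>.\<close>

lemma pinv_mult_orthonormal_rows:
  fixes T :: "real^'r^'r"
  assumes "invertible T" "transpose Q ** Q = mat 1"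
  shows "pinv (T ** transpose Q) = Q ** matrix_inv T"
proof (rule pinv_right_inverse)
  note T = matrix_inv_left_right[OF assms(1)]
  have "T ** transpose Q ** (Q ** matrix_inv T) = T ** (transpose Q ** Q) ** matrix_inv T"
    by (simp add: matrix_mul_assoc)
  then show "T ** transpose Q ** (Q ** matrix_inv T) = mat 1"
    by (simp add: assms(2) T)
  have "Q ** matrix_inv T ** (T ** transpose Q) = Q ** (matrix_inv T ** T) ** transpose Q"
    by (simp add: matrix_mul_assoc)
  then show "transpose (Q ** matrix_inv T ** (T ** transpose Q)) = Q ** matrix_inv T ** (T ** transpose Q)"
    by (simp add: T matrix_transpose_mul)
qed

theorem proposition3p4:
  fixes X Y :: "real^'n^'m"
    and Qx :: "real^('rx::{finite,linorder})^'m"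
    and Qy :: "real^'ry^'m"
    and Xt :: "real^'n^('rx::{finite,linorder})"
    and Yt :: "real^'n^'ry"
    and A :: "real^'m^'m"
    and Qxy :: "real^'ry^('rx::{finite,linorder})"
    and Gyx :: "real^('rx::{finite,linorder})^'ry"
    and Gx :: "real^('rx::{finite,linorder})^('rx::{finite,linorder})"
    and w :: "complex^('rx::{finite,linorder})"
    and l :: complex
    and z_ex :: "complex^'m"
  assumes "X = Qx ** Xt" and "Y = Qy ** Yt"
    and "orthonormal_columns Qx" and "orthonormal_columns Qy"
    and "full_row_rank Xt" and "full_row_rank Yt"
    and "A = Y ** pinv X"
    and "Qxy = transpose Qx ** Qy"
    and "Gyx = Yt ** transpose Xt"
    and "Gx = Xt ** transpose Xt"
    and "eigenpair (cmat (transpose Qx ** A ** Qx)) w l"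
    and "z_ex = exact_dmd_vector X Y Qx w"
  shows "invertible Gx \<and>
    transpose Qx ** A ** Qx = Qxy ** Gyx ** matrix_inv Gx \<and>
    z_ex = cmat (Qy ** Yt ** pinv Xt) *v w \<and>
    z_ex = cmat (Qy ** Gyx ** matrix_inv Gx) *v w \<and>
    cmat A *v z_ex = l *s z_ex \<and>
    (z_ex \<noteq> 0 \<longrightarrow> eigenpair (cmat A) z_ex l) \<and>
    (\<forall>(T :: real^('rx::{finite,linorder})^('rx::{finite,linorder}))
        (Qt :: real^('rx::{finite,linorder})^'n)
        (Gyq :: real^('rx::{finite,linorder})^'ry)
        (w_ex :: complex^'ry).
       triangular T \<and> Xt = T ** transpose Qt \<and> transpose Qt ** Qt = mat 1 \<and>
       Gyq = Yt ** Qt \<and> w_ex = cmat (Gyq ** matrix_inv T) *v w \<longrightarrow>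
       invertible T \<and> z_ex = cmat Qy *v w_ex)"
proof (intro conjI allI impI)
  note X = assms(1) and Y = assms(2) and A = assms(7) and Gx = assms(10)
  define B where "B = Y ** pinv Xt"
  have QQ: "transpose Qx ** Qx = mat 1"
    using assms(3) by (rule orthonormal_columns_transpose_mult)
  have AB: "A = B ** transpose Qx"
    by (simp add: A B_def X pinv_orthonormal_columns_mult[OF assms(3)] matrix_mul_assoc)
  have AQ: "A ** Qx = B"
    by (simp add: AB QQ flip: matrix_mul_assoc)
  \<comment> \<open>Folding \<open>Y ** pinv X\<close> back into \<open>A\<close> turns the
    definition into \<open>A ** Qx\<close> acting on \<open>w\<close>.\<close>
  have z: "z_ex = cmat B *v w"
    by (simp add: assms(12) exact_dmd_vector_def ritz_vector_def AQ matrix_vector_mul_assoc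
        flip: cmat_mult A)
  have B_Gram: "B = Qy ** Gyx ** matrix_inv Gx"
    by (simp add: B_def Y Gx assms(9) pinv_full_row_rank[OF assms(5)] matrix_mul_assoc)
  have eig: "cmat (transpose Qx ** B) *v w = l *s w"
    using assms(11) AQ by (simp add: eigenpair_def flip: matrix_mul_assoc)
  show "invertible Gx"
    using invertible_gram[OF assms(5)] Gx by simp
  show "transpose Qx ** A ** Qx = Qxy ** Gyx ** matrix_inv Gx"
    by (simp add: AQ B_Gram assms(8) flip: matrix_mul_assoc)
  show "z_ex = cmat (Qy ** Yt ** pinv Xt) *v w"
    by (simp add: z B_def Y)
  show "z_ex = cmat (Qy ** Gyx ** matrix_inv Gx) *v w"
    by (simp add: z B_Gram)
  show Az: "cmat A *v z_ex = l *s z_ex"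
  proof -
    have "cmat A *v z_ex = cmat B *v (cmat (transpose Qx ** B) *v w)"
      by (simp add: AB z matrix_vector_mul_assoc matrix_mul_assoc flip: cmat_mult)
    also have "\<dots> = l *s z_ex"
      by (simp add: eig z vector_scalar_commute)
    finally show ?thesis .
  qed
  show "eigenpair (cmat A) z_ex l" if "z_ex \<noteq> 0"
    using that Az by (simp add: eigenpair_def)
  fix T :: "real^('rx::{finite,linorder})^('rx::{finite,linorder})"
    and Qt :: "real^('rx::{finite,linorder})^'n"
    and Gyq :: "real^('rx::{finite,linorder})^'ry"
    and w_ex :: "complex^'ry"
  assume asm: "triangular T \<and> Xt = T ** transpose Qt \<and> transpose Qt ** Qt = mat 1 \<and>
       Gyq = Yt ** Qt \<and> w_ex = cmat (Gyq ** matrix_inv T) *v w"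
  \<comment> \<open>The full row rank of \<open>Xt\<close> passes to its left factor
    \<open>T\<close>, so \<open>matrix_inv T\<close> is a genuine inverse.\<close>
  then show T: "invertible T"
    using assms(5) invertible_left_factor by blast
  have "pinv Xt = Qt ** matrix_inv T"
    using asm T pinv_mult_orthonormal_rows by blast
  then have "B = Qy ** (Gyq ** matrix_inv T)"
    using asm by (simp add: B_def Y matrix_mul_assoc)
  then show "z_ex = cmat Qy *v w_ex"
    using asm by (simp add: z matrix_vector_mul_assoc flip: cmat_mult)
qed

end
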